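(* Let $X$ be a standard normal random vector in $\mathbb{R}^n$. Let $T \subset \mathbb{R}^n$ be any nonempty set with $\rho(T)>0$ and let $u>0$ be any number. Assume that $$r \ge 2\bar{w}(T) + \frac{u}{\rho(T)}.$$ Then there exists a Borel set $A \subset \mathbb{R}^n$ satisfying $$\mathbb{P}\{X \in A\} > 1-e^{-u^2/8} \quad \text{and} \quad \mathbb{P}\{X \in A-rT\} < e^{-u^2/8}.$$
   Context: For a nonempty set $T \subset \mathbb{R}^n\setminus\{0\}$, the scaled Gaussian width is $$\bar{w}(T) = \mathbb{E} \sup_{t \in T} \left\langle X, \frac{t}{\|t\|_2^2}\right\rangle,$$ where $X$ is a standard normal random vector in $\mathbb{R}^n$, and the inradius of $T$ is $\rho(T) = \inf_{t \in T} \|t\|_2$. For $A,T\subset\mathbb{R}^n$ and $r\in\mathbb{R}$, $A-rT = \{a-rt : a\in A,\ t\in T\}$. If $A-rT$ is not measurable, $\mathbb{P}\{X\in A-rT\}$ is understood as outer probability. *)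

theory Defs
  imports "HOL-Probability.Probability"
begin

definition std_normal_vector_density :: "real ^ 'n \<Rightarrow> real" where
  "std_normal_vector_density x = (\<Prod>i\<in>UNIV. std_normal_density (x $ i))"

definition std_normal_vector_measure :: "(real ^ 'n) measure" where
  "std_normal_vector_measure = density lborel (\<lambda>x. ennreal (std_normal_vector_density x))"

definition standard_normal_vector :: "'a measure \<Rightarrow> ('a \<Rightarrow> real ^ 'n) \<Rightarrow> bool" where
  "standard_normal_vector M X \<longleftrightarrow>
     prob_space M \<and> distributed M lborel X (\<lambda>x. ennreal (std_normal_vector_density x))"

text \<open>The supremum and the integral are real-valued, so they carry their mathematical meaning only
  if they are finite. This is the case for every nonempty \<open>T\<close> with positive inradius \<open>\<rho>\<close>, since
  the supremum at \<open>x\<close> is then bounded in absolute value by \<open>norm x / \<rho>\<close>; it is Borel measurable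
  for arbitrary \<open>T\<close> because it is lower semicontinuous.\<close>

definition scaled_gaussian_width :: "(real ^ 'n) set \<Rightarrow> real" where
  "scaled_gaussian_width T =
     (LINT x|std_normal_vector_measure. (SUP t\<in>T. x \<bullet> (t /\<^sub>R (norm t)\<^sup>2)))"

definition inradius :: "(real ^ 'n) set \<Rightarrow> real" where
  "inradius T = (INF t\<in>T. norm t)"

definition minus_scaled :: "(real ^ 'n) set \<Rightarrow> real \<Rightarrow> (real ^ 'n) set \<Rightarrow> (real ^ 'n) set" where
  "minus_scaled A r T = {a - r *\<^sub>R t | a t. a \<in> A \<and> t \<in> T}"

text \<open>The outer probability of \<open>{X \<in> S}\<close> is taken with respect to the law of \<open>X\<close>: the infimum of
  the probabilities of \<open>{X \<in> B}\<close> over all Borel sets \<open>B\<close> containing \<open>S\<close>. It equals the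
  probability of \<open>{X \<in> S}\<close> if \<open>S\<close> is Borel, and it is an upper bound for the outer measure
  with respect to \<open>M\<close> of the event \<open>{X \<in> S}\<close>.\<close>

definition outer_prob_in :: "'a measure \<Rightarrow> ('a \<Rightarrow> real ^ 'n) \<Rightarrow> (real ^ 'n) set \<Rightarrow> ennreal" where
  "outer_prob_in M X S = outer_measure_of (distr M borel X) S"

end

theory Submission
  imports Defs
begin

text \<open>The function \<open>f x = (SUP t\<in>T. x \<bullet> (t /\<^sub>R (norm t)\<^sup>2))\<close> is Lipschitz with constant \<open>1 / \<rho>\<close> and has
  Gaussian mean \<open>w\<close>, the scaled Gaussian width. With \<open>k = w + u / (2 * \<rho>)\<close> and \<open>A = {x. f x < k}\<close>,
  the complement of \<open>A\<close> is an upper tail of \<open>f\<close>. Since \<open>t\<close> has inner product \<open>1\<close> with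
  \<open>t /\<^sub>R (norm t)\<^sup>2\<close>, every \<open>z = a - r *\<^sub>R t\<close> with \<open>a \<in> A\<close> satisfies \<open>f (- z) > r - k \<ge> k\<close>, so the
  second event lies in the reflection of the same tail. Gaussian concentration with the sharp
  constant bounds the tail by \<open>exp (- u\<^sup>2 / 8)\<close>; it is derived from the Prekopa-Leindler
  inequality and Jensen's inequality, in the spirit of Maurey's infimum convolution.\<close>

section \<open>Brunn-Minkowski on the line\<close>

lemma emeasure_lborel_translate:
  fixes A :: "real set"
  assumes [measurable]: "A \<in> sets borel"
  shows "emeasure lborel {x. x - c \<in> A} = emeasure lborel A"
proof -
  have "emeasure lborel {x. x - c \<in> A} = (\<integral>\<^sup>+x. indicator {x. x - c \<in> A} x \<partial>lborel)"
    by simp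
  also have "\<dots> = (\<integral>\<^sup>+x. indicator {x. x - c \<in> A} (c + 1 * x) \<partial>lborel)"
    by (subst nn_integral_real_affine[where c=1 and t=c]) auto
  also have "\<dots> = (\<integral>\<^sup>+x. indicator A x \<partial>lborel)"
    by (intro nn_integral_cong) (auto simp: indicator_def)
  finally show ?thesis by simp
qed

lemma emeasure_lborel_scale:
  fixes A :: "real set"
  assumes [measurable]: "A \<in> sets borel" and c: "c > 0"
  shows "emeasure lborel {x. x / c \<in> A} = ennreal c * emeasure lborel A"
proof -
  have "emeasure lborel {x. x / c \<in> A} = (\<integral>\<^sup>+x. indicator {x. x / c \<in> A} x \<partial>lborel)"
    by simp
  also have "\<dots> = ennreal c * (\<integral>\<^sup>+x. indicator {x. x / c \<in> A} (0 + c * x) \<partial>lborel)"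
    using c by (subst nn_integral_real_affine[where c=c and t=0]) auto
  also have "(\<integral>\<^sup>+x. indicator {x. x / c \<in> A} (0 + c * x) \<partial>lborel) = (\<integral>\<^sup>+x. indicator A x \<partial>lborel)"
    using c by (intro nn_integral_cong) (auto simp: indicator_def)
  finally show ?thesis by simp
qed

text \<open>For \<open>a\<close> close to \<open>Sup A\<close> and \<open>b\<close> close to \<open>Inf B\<close>, the translates \<open>A + b\<close> and \<open>a + B\<close> both lie
  in \<open>C\<close> and overlap only in a short interval.\<close>

lemma brunn_minkowski_bounded_real:
  fixes A B C :: "real set"
  assumes [measurable]: "A \<in> sets borel" "B \<in> sets borel" "C \<in> sets borel"
    and ne: "A \<noteq> {}" "B \<noteq> {}" and bdd: "bdd_above A" "bdd_below B"
    and sum: "\<And>a b. a \<in> A \<Longrightarrow> b \<in> B \<Longrightarrow> a + b \<in> C"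
  shows "emeasure lborel A + emeasure lborel B \<le> emeasure lborel C"
proof (rule ennreal_le_epsilon)
  fix e :: real assume e: "0 < e"
  \<comment> \<open>A slack of \<open>e / 2\<close> at each end leaves the overlap interval below
    with length less than \<open>e\<close>, namely \<open>(Sup A - a) + (b - Inf B)\<close>.\<close>
  obtain a where a: "a \<in> A" "Sup A - e / 2 < a"
    using less_cSup_iff[OF ne(1) bdd(1), of "Sup A - e / 2"] e by auto
  obtain b where b: "b \<in> B" "b < Inf B + e / 2"
    using cInf_less_iff[OF ne(2) bdd(2), of "Inf B + e / 2"] e by auto
  define P where "P = {x. x - b \<in> A}"
  define Q where "Q = {x. x - a \<in> B}"
  have [measurable]: "P \<in> sets borel" "Q \<in> sets borel"
    unfolding P_def Q_def by measurable
  have "P \<inter> Q \<subseteq> {a + Inf B .. Sup A + b}"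
  proof
    fix x assume "x \<in> P \<inter> Q"
    then have "x - b \<le> Sup A" "Inf B \<le> x - a"
      using bdd by (auto simp: P_def Q_def intro: cSup_upper cInf_lower)
    then show "x \<in> {a + Inf B .. Sup A + b}" by auto
  qed
  then have "emeasure lborel (P \<inter> Q) \<le> emeasure lborel {a + Inf B .. Sup A + b}"
    by (intro emeasure_mono) auto
  also have "\<dots> \<le> ennreal e"
    using a b by (auto simp: emeasure_lborel_Icc_eq intro!: ennreal_leI)
  finally have PQ: "emeasure lborel (P \<inter> Q) \<le> ennreal e" .
  have "P \<union> Q \<subseteq> C"
    using sum[OF _ b(1)] sum[OF a(1)] by (force simp: P_def Q_def)
  then have C: "emeasure lborel (P \<union> Q) \<le> emeasure lborel C"
    by (intro emeasure_mono) auto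
  have "emeasure lborel A + emeasure lborel B = emeasure lborel P + emeasure lborel Q"
    by (simp add: P_def Q_def emeasure_lborel_translate)
  also have "\<dots> = emeasure lborel (P \<union> Q) + emeasure lborel (P \<inter> Q)"
    by (rule emeasure_Un_Int) auto
  also have "\<dots> \<le> emeasure lborel C + ennreal e"
    using C PQ by (rule add_mono)
  finally show "emeasure lborel A + emeasure lborel B \<le> emeasure lborel C + ennreal e" .
qed

text \<open>Truncation to the intervals \<open>[-n, n]\<close> reduces this to the bounded case, and
  continuity of measure from below removes the truncation.\<close>

lemma brunn_minkowski_real:
  fixes A B C :: "real set"
  assumes [measurable]: "A \<in> sets borel" "B \<in> sets borel" "C \<in> sets borel"
    and ne: "A \<noteq> {}" "B \<noteq> {}"
    and sum: "\<And>a b. a \<in> A \<Longrightarrow> b \<in> B \<Longrightarrow> a + b \<in> C"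
  shows "emeasure lborel A + emeasure lborel B \<le> emeasure lborel C"
proof -
  define I where "I n = {- real n .. real n}" for n
  have [measurable]: "I n \<in> sets borel" for n by (simp add: I_def)
  have lim: "(\<lambda>n. emeasure lborel (S \<inter> I n)) \<longlonglongrightarrow> emeasure lborel S"
    if [measurable]: "S \<in> sets borel" for S
  proof -
    have "(\<Union>n. S \<inter> I n) = S"
    proof (intro equalityI subsetI)
      fix x assume "x \<in> S"
      obtain n where "\<bar>x\<bar> \<le> real n" using real_arch_simple by blast
      then have "x \<in> S \<inter> I n" using \<open>x \<in> S\<close> by (auto simp: I_def)
      then show "x \<in> (\<Union>n. S \<inter> I n)" by blast
    qed auto
    moreover have "incseq (\<lambda>n. S \<inter> I n)" by (auto simp: incseq_def I_def)
    moreover have "range (\<lambda>n. S \<inter> I n) \<subseteq> sets lborel" by auto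
    ultimately show ?thesis using Lim_emeasure_incseq[of "\<lambda>n. S \<inter> I n" lborel] by simp
  qed
  obtain a b where ab: "a \<in> A" "b \<in> B" using ne by auto
  \<comment> \<open>From \<open>N\<close> on, both truncated sets contain a chosen point, as the
    bounded case requires nonempty sets.\<close>
  obtain N where N: "max \<bar>a\<bar> \<bar>b\<bar> \<le> real N" using real_arch_simple by blast
  show ?thesis
  proof (rule LIMSEQ_le_const2)
    show "(\<lambda>n. emeasure lborel (A \<inter> I n) + emeasure lborel (B \<inter> I n))
        \<longlonglongrightarrow> emeasure lborel A + emeasure lborel B"
      by (intro tendsto_add lim) auto
    have "emeasure lborel (A \<inter> I n) + emeasure lborel (B \<inter> I n) \<le> emeasure lborel C" if "n \<ge> N" for n
    proof (rule brunn_minkowski_bounded_real)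
      show "A \<inter> I n \<noteq> {}" "B \<inter> I n \<noteq> {}"
        using ab N that by (force simp: I_def)+
      show "bdd_above (A \<inter> I n)" "bdd_below (B \<inter> I n)" by (auto simp: I_def)
    qed (use sum in auto)
    then show "\<exists>N. \<forall>n\<ge>N. emeasure lborel (A \<inter> I n) + emeasure lborel (B \<inter> I n) \<le> emeasure lborel C"
      by blast
  qed
qed

text \<open>Apply the additive form to the dilates of \<open>A\<close> by \<open>s\<close> and of
  \<open>B\<close> by \<open>1 - s\<close>; on the line, a dilation multiplies the measure by its
  factor.\<close>

lemma brunn_minkowski_real_convex:
  fixes A B C :: "real set"
  assumes [measurable]: "A \<in> sets borel" "B \<in> sets borel" "C \<in> sets borel"
    and ne: "A \<noteq> {}" "B \<noteq> {}" and s: "0 < s" "s < 1"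
    and sum: "\<And>a b. a \<in> A \<Longrightarrow> b \<in> B \<Longrightarrow> s * a + (1 - s) * b \<in> C"
  shows "ennreal s * emeasure lborel A + ennreal (1 - s) * emeasure lborel B \<le> emeasure lborel C"
proof -
  have *: "s * a \<in> {x. x / s \<in> A}" "(1 - s) * b \<in> {x. x / (1 - s) \<in> B}" if "a \<in> A" "b \<in> B" for a b
    using that s by auto
  have "emeasure lborel {x. x / s \<in> A} + emeasure lborel {x. x / (1 - s) \<in> B} \<le> emeasure lborel C"
  proof (rule brunn_minkowski_real)
    show "{x. x / s \<in> A} \<noteq> {}" "{x. x / (1 - s) \<in> B} \<noteq> {}" using * ne by blast+
    fix a b assume "a \<in> {x. x / s \<in> A}" "b \<in> {x. x / (1 - s) \<in> B}"
    then show "a + b \<in> C" using sum[of "a / s" "b / (1 - s)"] s by simp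
  qed auto
  then show ?thesis using s by (simp add: emeasure_lborel_scale)
qed

section \<open>The Prekopa-Leindler inequality\<close>

lemma measurable_emeasure_superlevel [measurable]:
  fixes h :: "real \<Rightarrow> ennreal"
  assumes [measurable]: "h \<in> borel_measurable borel"
  shows "(\<lambda>t. emeasure lborel {x. ennreal (t * c) \<le> h x}) \<in> borel_measurable borel"
    and "(\<lambda>t. emeasure lborel {x. ennreal (t * c) < h x}) \<in> borel_measurable borel"
proof -
  have "(\<lambda>t. \<integral>\<^sup>+x. indicator {x. ennreal (t * c) \<le> h x} x \<partial>lborel) \<in> borel_measurable borel"
    by measurable
  then show "(\<lambda>t. emeasure lborel {x. ennreal (t * c) \<le> h x}) \<in> borel_measurable borel"
    by simp
  have "(\<lambda>t. \<integral>\<^sup>+x. indicator {x. ennreal (t * c) < h x} x \<partial>lborel) \<in> borel_measurable borel"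
    by measurable
  then show "(\<lambda>t. emeasure lborel {x. ennreal (t * c) < h x}) \<in> borel_measurable borel"
    by simp
qed

text \<open>After Fubini, the heights \<open>t\<close> that count for a fixed \<open>x\<close> lie
  in \<open>[0, h x / c]\<close>; cutting them off at \<open>1\<close> can only lose mass. The
  superlevel set is closed because \<open>wgm_le\<close> yields only a weak inequality for
  \<open>h\<close>.\<close>

lemma layer_cake_le:
  fixes h :: "real \<Rightarrow> ennreal"
  assumes [measurable]: "h \<in> borel_measurable borel" and c: "c > 0"
  shows "ennreal c * (\<integral>\<^sup>+t. emeasure lborel {x. ennreal (t * c) \<le> h x} * indicator {0<..<1} t \<partial>lborel)
    \<le> (\<integral>\<^sup>+x. h x \<partial>lborel)"
proof -
  have "(\<integral>\<^sup>+t. emeasure lborel {x. ennreal (t * c) \<le> h x} * indicator {0<..<1} t \<partial>lborel)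
    = (\<integral>\<^sup>+t. (\<integral>\<^sup>+x. indicator {x. ennreal (t * c) \<le> h x} x * indicator {0<..<1} t \<partial>lborel) \<partial>lborel)"
    by (simp add: nn_integral_multc)
  also have "\<dots> = (\<integral>\<^sup>+x. (\<integral>\<^sup>+t. indicator {x. ennreal (t * c) \<le> h x} x * indicator {0<..<1} t \<partial>lborel) \<partial>lborel)"
    by (rule lborel_pair.Fubini') measurable
  also have "ennreal c * \<dots> = (\<integral>\<^sup>+x. ennreal c * (\<integral>\<^sup>+t. indicator {x. ennreal (t * c) \<le> h x} x * indicator {0<..<1} t \<partial>lborel) \<partial>lborel)"
    by (rule nn_integral_cmult[symmetric]) measurable
  also have "\<dots> \<le> (\<integral>\<^sup>+x. h x \<partial>lborel)"
  proof (rule nn_integral_mono)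
    fix x
    show "ennreal c * (\<integral>\<^sup>+t. indicator {x. ennreal (t * c) \<le> h x} x * indicator {0<..<1} t \<partial>lborel) \<le> h x"
    proof (cases "h x")
      case (real y)
      have "(\<integral>\<^sup>+t. indicator {x. ennreal (t * c) \<le> h x} x * indicator {0<..<1} t \<partial>lborel)
        \<le> (\<integral>\<^sup>+t. indicator {0..y / c} t \<partial>lborel)"
        using real c by (intro nn_integral_mono) (auto simp: indicator_def field_simps)
      also have "\<dots> = ennreal (y / c)" using real c by simp
      finally have "ennreal c * (\<integral>\<^sup>+t. indicator {x. ennreal (t * c) \<le> h x} x * indicator {0<..<1} t \<partial>lborel) \<le> ennreal c * ennreal (y / c)"
        by (rule mult_left_mono) simp
      also have "\<dots> = h x" using real c by (simp add: ennreal_mult[symmetric])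
      finally show ?thesis .
    qed simp
  qed
  finally show ?thesis .
qed

text \<open>The bound \<open>h x \<le> c\<close> puts all relevant heights \<open>t\<close> below
  \<open>1\<close>, so the cutoff loses nothing. The superlevel set is strict to match the strict
  premises of \<open>wgm_le\<close>.\<close>

lemma layer_cake_ge:
  fixes h :: "real \<Rightarrow> ennreal"
  assumes [measurable]: "h \<in> borel_measurable borel" and c: "c > 0" and le: "\<And>x. h x \<le> ennreal c"
  shows "(\<integral>\<^sup>+x. h x \<partial>lborel) \<le>
    ennreal c * (\<integral>\<^sup>+t. emeasure lborel {x. ennreal (t * c) < h x} * indicator {0<..<1} t \<partial>lborel)"
proof -
  have "(\<integral>\<^sup>+x. h x \<partial>lborel) \<le>
     (\<integral>\<^sup>+x. ennreal c * (\<integral>\<^sup>+t. indicator {x. ennreal (t * c) < h x} x * indicator {0<..<1} t \<partial>lborel) \<partial>lborel)"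
  proof (rule nn_integral_mono)
    fix x
    obtain y where y: "h x = ennreal y" "0 \<le> y" "y \<le> c"
      using le[of x] c by (cases "h x") (auto simp: top_unique)
    have "h x = ennreal c * ennreal (y / c)" using y c by (simp add: ennreal_mult[symmetric])
    also have "ennreal (y / c) = (\<integral>\<^sup>+t. indicator {0<..<y / c} t \<partial>lborel)" using y c by simp
    also have "\<dots> \<le> (\<integral>\<^sup>+t. indicator {x. ennreal (t * c) < h x} x * indicator {0<..<1} t \<partial>lborel)"
    proof (rule nn_integral_mono)
      fix t :: real
      have "t * c < y \<and> t < 1" if "0 < t" "t < y / c"
        using that y c by (simp add: less_divide_eq) (use mult_right_mono[of 1 t c] in linarith)
      then show "indicator {0<..<y / c} t \<le>
          (indicator {x. ennreal (t * c) < h x} x * indicator {0<..<1} t :: ennreal)"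
        using y c by (auto simp: indicator_def ennreal_less_iff)
    qed
    finally show "h x \<le> ennreal c * (\<integral>\<^sup>+t. indicator {x. ennreal (t * c) < h x} x * indicator {0<..<1} t \<partial>lborel)"
      by (simp add: mult_left_mono)
  qed
  also have "\<dots> = ennreal c * (\<integral>\<^sup>+x. (\<integral>\<^sup>+t. indicator {x. ennreal (t * c) < h x} x * indicator {0<..<1} t \<partial>lborel) \<partial>lborel)"
    by (rule nn_integral_cmult) measurable
  also have "(\<integral>\<^sup>+x. (\<integral>\<^sup>+t. indicator {x. ennreal (t * c) < h x} x * indicator {0<..<1} t \<partial>lborel) \<partial>lborel)
    = (\<integral>\<^sup>+t. (\<integral>\<^sup>+x. indicator {x. ennreal (t * c) < h x} x * indicator {0<..<1} t \<partial>lborel) \<partial>lborel)"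
    by (rule lborel_pair.Fubini') measurable
  also have "\<dots> = (\<integral>\<^sup>+t. emeasure lborel {x. ennreal (t * c) < h x} * indicator {0<..<1} t \<partial>lborel)"
    by (simp add: nn_integral_multc)
  finally show ?thesis .
qed

text \<open>\<open>wgm_le s p q w\<close> says that the weighted geometric mean of \<open>p\<close> and \<open>q\<close> with weights \<open>s\<close> and
  \<open>1 - s\<close> is at most \<open>w\<close>, where the mean is \<open>0\<close> if \<open>p\<close> or \<open>q\<close> is, even if the other is infinite.
  The strict inequalities make the predicate compatible with monotone limits in \<open>p\<close> and \<open>q\<close>.\<close>

definition wgm_le :: "real \<Rightarrow> ennreal \<Rightarrow> ennreal \<Rightarrow> ennreal \<Rightarrow> bool" where
  "wgm_le s p q w \<longleftrightarrow> (\<forall>a b. 0 < a \<longrightarrow> 0 < b \<longrightarrow> ennreal a < p \<longrightarrow> ennreal b < q \<longrightarrow>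
     ennreal (a powr s * b powr (1 - s)) \<le> w)"

lemma wgm_leD:
  "wgm_le s p q w \<Longrightarrow> 0 < a \<Longrightarrow> 0 < b \<Longrightarrow> ennreal a < p \<Longrightarrow> ennreal b < q \<Longrightarrow>
     ennreal (a powr s * b powr (1 - s)) \<le> w"
  by (simp add: wgm_le_def)

lemma wgm_le_mono: "wgm_le s p q w \<Longrightarrow> p' \<le> p \<Longrightarrow> q' \<le> q \<Longrightarrow> wgm_le s p' q' w"
  unfolding wgm_le_def by (meson less_le_trans)

text \<open>After scaling both suprema to \<open>1\<close>, all superlevel sets at heights below \<open>1\<close> are nonempty, so
  Brunn-Minkowski applies to them; AM-GM passes from the arithmetic to the geometric mean.\<close>

lemma prekopa_leindler_real_bounded:
  fixes u v h :: "real \<Rightarrow> ennreal"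
  assumes [measurable]: "u \<in> borel_measurable borel" "v \<in> borel_measurable borel" "h \<in> borel_measurable borel"
    and s: "0 < s" "s < 1"
    and le: "\<And>x y. wgm_le s (u x) (v y) (h (s * x + (1 - s) * y))"
    and bdd: "(SUP x. u x) < \<top>" "(SUP x. v x) < \<top>"
  shows "wgm_le s (\<integral>\<^sup>+x. u x \<partial>lborel) (\<integral>\<^sup>+x. v x \<partial>lborel) (\<integral>\<^sup>+x. h x \<partial>lborel)"
  unfolding wgm_le_def
proof safe
  fix a b :: real
  assume a: "0 < a" "ennreal a < (\<integral>\<^sup>+x. u x \<partial>lborel)" and b: "0 < b" "ennreal b < (\<integral>\<^sup>+x. v x \<partial>lborel)"
  obtain U where U: "(SUP x. u x) = ennreal U" "0 \<le> U"
    using bdd(1) by (cases "SUP x. u x") auto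
  obtain V where V: "(SUP x. v x) = ennreal V" "0 \<le> V"
    using bdd(2) by (cases "SUP x. v x") auto
  have uU: "u x \<le> ennreal U" for x unfolding U(1)[symmetric] by (rule SUP_upper) simp
  have vV: "v x \<le> ennreal V" for x unfolding V(1)[symmetric] by (rule SUP_upper) simp
  have "U \<noteq> 0" using uU a by auto
  then have U0: "U > 0" using U by simp
  have "V \<noteq> 0" using vV b by auto
  then have V0: "V > 0" using V by simp
  \<comment> \<open>Since the weights sum to \<open>1\<close>, the levels \<open>t * U\<close> and
    \<open>t * V\<close> have weighted geometric mean \<open>t * c\<close>. Hence \<open>c\<close>
    is the scale on which the heights of \<open>h\<close> are measured.\<close>
  define c where "c = U powr s * V powr (1 - s)"
  have c0: "c > 0" using U0 V0 by (simp add: c_def)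
  define IU where "IU = (\<integral>\<^sup>+t. emeasure lborel {x. ennreal (t * U) < u x} * indicator {0<..<1} t \<partial>lborel)"
  define IV where "IV = (\<integral>\<^sup>+t. emeasure lborel {x. ennreal (t * V) < v x} * indicator {0<..<1} t \<partial>lborel)"
  define IH where "IH = (\<integral>\<^sup>+t. emeasure lborel {x. ennreal (t * c) \<le> h x} * indicator {0<..<1} t \<partial>lborel)"
  have "ennreal U * ennreal (a / U) = ennreal a" using U0 a by (simp add: ennreal_mult[symmetric])
  also have "\<dots> \<le> ennreal U * IU"
    using layer_cake_ge[of u U] uU U0 a by (simp add: IU_def)
  finally have aU: "ennreal (a / U) \<le> IU" using U0 by (simp add: ennreal_mult_le_mult_iff)
  have "ennreal V * ennreal (b / V) = ennreal b" using V0 b by (simp add: ennreal_mult[symmetric])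
  also have "\<dots> \<le> ennreal V * IV"
    using layer_cake_ge[of v V] vV V0 b by (simp add: IV_def)
  finally have bV: "ennreal (b / V) \<le> IV" using V0 by (simp add: ennreal_mult_le_mult_iff)
  have "ennreal s * IU + ennreal (1 - s) * IV =
     (\<integral>\<^sup>+t. (ennreal s * emeasure lborel {x. ennreal (t * U) < u x} +
             ennreal (1 - s) * emeasure lborel {x. ennreal (t * V) < v x}) * indicator {0<..<1} t \<partial>lborel)"
    by (simp add: IU_def IV_def distrib_right nn_integral_add nn_integral_cmult mult.assoc)
  also have "\<dots> \<le> IH"
    unfolding IH_def
  proof (rule nn_integral_mono)
    fix t :: real
    have "ennreal s * emeasure lborel {x. ennreal (t * U) < u x} +
             ennreal (1 - s) * emeasure lborel {x. ennreal (t * V) < v x} \<le> emeasure lborel {x. ennreal (t * c) \<le> h x}"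
      if t: "0 < t" "t < 1"
    proof (rule brunn_minkowski_real_convex[OF _ _ _ _ _ s])
      have "ennreal (t * U) < (SUP x. u x)" using t U0 by (simp add: U(1) ennreal_less_iff)
      then show "{x. ennreal (t * U) < u x} \<noteq> {}" by (auto simp: less_SUP_iff)
      have "ennreal (t * V) < (SUP x. v x)" using t V0 by (simp add: V(1) ennreal_less_iff)
      then show "{x. ennreal (t * V) < v x} \<noteq> {}" by (auto simp: less_SUP_iff)
      fix x y assume "x \<in> {x. ennreal (t * U) < u x}" "y \<in> {x. ennreal (t * V) < v x}"
      then have "ennreal ((t * U) powr s * (t * V) powr (1 - s)) \<le> h (s * x + (1 - s) * y)"
        using t U0 V0 by (intro wgm_leD[OF le]) auto
      also have "(t * U) powr s * (t * V) powr (1 - s) = (t powr s * t powr (1 - s)) * c"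
        using t U0 V0 by (simp add: powr_mult c_def)
      also have "t powr s * t powr (1 - s) = t"
        using t by (simp add: powr_add[symmetric])
      finally show "s * x + (1 - s) * y \<in> {x. ennreal (t * c) \<le> h x}" by simp
    qed measurable
    then show "(ennreal s * emeasure lborel {x. ennreal (t * U) < u x} +
             ennreal (1 - s) * emeasure lborel {x. ennreal (t * V) < v x}) * indicator {0<..<1} t
      \<le> emeasure lborel {x. ennreal (t * c) \<le> h x} * indicator {0<..<1} t"
      by (auto simp: indicator_def)
  qed
  finally have IH: "ennreal s * IU + ennreal (1 - s) * IV \<le> IH" .
  have "a powr s * b powr (1 - s) = c * ((a / U) powr s * (b / V) powr (1 - s))"
    using a b U0 V0 by (simp add: c_def powr_divide)
  also have "\<dots> \<le> c * (s * (a / U) + (1 - s) * (b / V))"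
    using s a b U0 V0 c0 by (intro mult_left_mono Youngs_inequality_0) auto
  finally have "ennreal (a powr s * b powr (1 - s)) \<le> ennreal (c * (s * (a / U) + (1 - s) * (b / V)))"
    by (rule ennreal_leI)
  also have "\<dots> = ennreal c * (ennreal s * ennreal (a / U) + ennreal (1 - s) * ennreal (b / V))"
    using s a b U0 V0 c0 by (simp add: ennreal_mult[symmetric] ennreal_plus[symmetric] del: ennreal_plus)
  also have "\<dots> \<le> ennreal c * (ennreal s * IU + ennreal (1 - s) * IV)"
    using aU bV by (intro mult_left_mono add_mono) auto
  also have "\<dots> \<le> ennreal c * IH" using IH by (rule mult_left_mono) simp
  also have "\<dots> \<le> (\<integral>\<^sup>+x. h x \<partial>lborel)" unfolding IH_def by (rule layer_cake_le) (use c0 in auto)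
  finally show "ennreal (a powr s * b powr (1 - s)) \<le> (\<integral>\<^sup>+x. h x \<partial>lborel)" .
qed

text \<open>Monotone convergence for truncations at integer heights, which increase to the function
  even where it is infinite.\<close>

lemma nn_integral_SUP_min:
  assumes [measurable]: "u \<in> borel_measurable M"
  shows "(SUP n. \<integral>\<^sup>+x. min (u x) (of_nat n) \<partial>M) = (\<integral>\<^sup>+x. u x \<partial>M)"
proof -
  have "(SUP n. min y (of_nat n)) = y" for y :: ennreal
  proof (rule antisym)
    show "y \<le> (SUP n. min y (of_nat n))"
    proof (rule dense_le)
      fix z assume z: "z < y"
      then have "z < \<top>" by (auto simp: less_top intro: less_le_trans)
      then obtain n where "z < of_nat n" using ennreal_Ex_less_of_nat by blast
      then have "z \<le> min y (of_nat n)" using z by (simp add: less_imp_le)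
      also have "\<dots> \<le> (SUP n. min y (of_nat n))" by (rule SUP_upper) simp
      finally show "z \<le> (SUP n. min y (of_nat n))" .
    qed
  qed (rule SUP_least, simp)
  then have "(\<integral>\<^sup>+x. u x \<partial>M) = (\<integral>\<^sup>+x. (SUP n. min (u x) (of_nat n)) \<partial>M)" by simp
  also have "\<dots> = (SUP n. \<integral>\<^sup>+x. min (u x) (of_nat n) \<partial>M)"
    by (intro nn_integral_monotone_convergence_SUP) (auto simp: incseq_def le_fun_def min_le_iff_disj)
  finally show ?thesis by simp
qed

text \<open>Numbers strictly below the integrals of \<open>u\<close> and \<open>v\<close> are still
  below the integrals of suitable truncations, to which the bounded case applies.\<close>

lemma prekopa_leindler_real:
  fixes u v h :: "real \<Rightarrow> ennreal"
  assumes [measurable]: "u \<in> borel_measurable borel" "v \<in> borel_measurable borel" "h \<in> borel_measurable borel"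
    and s: "0 < s" "s < 1"
    and le: "\<And>x y. wgm_le s (u x) (v y) (h (s * x + (1 - s) * y))"
  shows "wgm_le s (\<integral>\<^sup>+x. u x \<partial>lborel) (\<integral>\<^sup>+x. v x \<partial>lborel) (\<integral>\<^sup>+x. h x \<partial>lborel)"
  unfolding wgm_le_def
proof safe
  fix a b :: real
  assume a: "0 < a" "ennreal a < (\<integral>\<^sup>+x. u x \<partial>lborel)" and b: "0 < b" "ennreal b < (\<integral>\<^sup>+x. v x \<partial>lborel)"
  obtain m where m: "ennreal a < (\<integral>\<^sup>+x. min (u x) (of_nat m) \<partial>lborel)"
    using a(2) nn_integral_SUP_min[of u lborel, symmetric] by (auto simp: less_SUP_iff)
  obtain n where n: "ennreal b < (\<integral>\<^sup>+x. min (v x) (of_nat n) \<partial>lborel)"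
    using b(2) nn_integral_SUP_min[of v lborel, symmetric] by (auto simp: less_SUP_iff)
  have fin: "(SUP x. min (f x) (of_nat k)) < \<top>" for f :: "real \<Rightarrow> ennreal" and k
  proof -
    have "(SUP x. min (f x) (of_nat k)) \<le> of_nat k" by (rule SUP_least) simp
    then show ?thesis by (rule le_less_trans) (simp add: ennreal_of_nat_eq_real_of_nat)
  qed
  show "ennreal (a powr s * b powr (1 - s)) \<le> (\<integral>\<^sup>+x. h x \<partial>lborel)"
    by (rule wgm_leD[OF prekopa_leindler_real_bounded a(1) b(1) m n])
       (use s fin in \<open>auto intro: wgm_le_mono[OF le]\<close>)
qed

text \<open>Induction on the coordinates: by the one-dimensional case, integrating out one
  coordinate of \<open>u\<close>, \<open>v\<close> and \<open>h\<close> leaves functions of the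
  others that again satisfy the pointwise hypothesis. Points are restricted to
  \<open>extensional I\<close>, where the product measure lives.\<close>

lemma prekopa_leindler_PiM:
  fixes u v h :: "('i \<Rightarrow> real) \<Rightarrow> ennreal"
  assumes "finite I"
    and "u \<in> borel_measurable (Pi\<^sub>M I (\<lambda>_. lborel))" "v \<in> borel_measurable (Pi\<^sub>M I (\<lambda>_. lborel))"
      "h \<in> borel_measurable (Pi\<^sub>M I (\<lambda>_. lborel))"
    and s: "0 < s" "s < 1"
    and "\<And>x y. x \<in> extensional I \<Longrightarrow> y \<in> extensional I \<Longrightarrow>
      wgm_le s (u x) (v y) (h (\<lambda>i\<in>I. s * x i + (1 - s) * y i))"
  shows "wgm_le s (\<integral>\<^sup>+x. u x \<partial>Pi\<^sub>M I (\<lambda>_. lborel)) (\<integral>\<^sup>+x. v x \<partial>Pi\<^sub>M I (\<lambda>_. lborel))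
    (\<integral>\<^sup>+x. h x \<partial>Pi\<^sub>M I (\<lambda>_. lborel))"
  using assms(1-4,7)
proof (induction I arbitrary: u v h rule: finite_induct)
  \<comment> \<open>The space is a single point of mass \<open>1\<close>, so the claim is the
    pointwise hypothesis there.\<close>
  case empty
  interpret product_sigma_finite "\<lambda>_. lborel :: real measure" ..
  have "(\<integral>\<^sup>+x. f x \<partial>Pi\<^sub>M {} (\<lambda>_. lborel)) = f (\<lambda>_. undefined)" for f :: "('i \<Rightarrow> real) \<Rightarrow> ennreal"
  proof -
    have "(\<integral>\<^sup>+x. f x \<partial>Pi\<^sub>M {} (\<lambda>_. lborel)) = (\<integral>\<^sup>+x. f (\<lambda>_. undefined) \<partial>Pi\<^sub>M ({} :: 'i set) (\<lambda>_. lborel :: real measure))"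
      by (intro nn_integral_cong) (simp add: space_PiM_empty)
    then show ?thesis by (simp add: space_PiM_empty)
  qed
  then show ?case using empty.prems(4)[of "\<lambda>_. undefined" "\<lambda>_. undefined"]
    by (simp add: restrict_def)
next
  case (insert i I)
  interpret product_sigma_finite "\<lambda>_. lborel :: real measure" ..
  note [measurable] = insert.prems(1-3)
  have meas: "(\<lambda>x. \<integral>\<^sup>+t. f (x(i := t)) \<partial>lborel) \<in> borel_measurable (Pi\<^sub>M I (\<lambda>_. lborel))"
    if [measurable]: "f \<in> borel_measurable (Pi\<^sub>M (insert i I) (\<lambda>_. lborel))" for f :: "('i \<Rightarrow> real) \<Rightarrow> ennreal"
    by measurable
  have sec: "(\<lambda>t. f (x(i := t))) \<in> borel_measurable borel"
    if "f \<in> borel_measurable (Pi\<^sub>M (insert i I) (\<lambda>_. lborel))" "x \<in> extensional I"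
    for f :: "('i \<Rightarrow> real) \<Rightarrow> ennreal" and x
  proof -
    have "(\<lambda>t. x(i := t)) \<in> lborel \<rightarrow>\<^sub>M Pi\<^sub>M (insert i I) (\<lambda>_. lborel)"
      using that(2) insert.hyps(2) by (intro measurable_component_update) (auto simp: space_PiM PiE_def)
    from measurable_compose[OF this that(1)] show ?thesis by simp
  qed
  have "wgm_le s (\<integral>\<^sup>+x. (\<integral>\<^sup>+t. u (x(i := t)) \<partial>lborel) \<partial>Pi\<^sub>M I (\<lambda>_. lborel))
     (\<integral>\<^sup>+x. (\<integral>\<^sup>+t. v (x(i := t)) \<partial>lborel) \<partial>Pi\<^sub>M I (\<lambda>_. lborel))
     (\<integral>\<^sup>+x. (\<integral>\<^sup>+t. h (x(i := t)) \<partial>lborel) \<partial>Pi\<^sub>M I (\<lambda>_. lborel))"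
  proof (rule insert.IH)
    fix x y :: "'i \<Rightarrow> real" assume xy: "x \<in> extensional I" "y \<in> extensional I"
    let ?z = "\<lambda>j\<in>I. s * x j + (1 - s) * y j"
    show "wgm_le s (\<integral>\<^sup>+t. u (x(i := t)) \<partial>lborel) (\<integral>\<^sup>+t. v (y(i := t)) \<partial>lborel) (\<integral>\<^sup>+t. h (?z(i := t)) \<partial>lborel)"
    proof (rule prekopa_leindler_real)
      fix a b :: real
      have "x(i := a) \<in> extensional (insert i I)" "y(i := b) \<in> extensional (insert i I)"
        using xy by (auto simp: extensional_def)
      from insert.prems(4)[OF this]
      show "wgm_le s (u (x(i := a))) (v (y(i := b))) (h (?z(i := s * a + (1 - s) * b)))"
        \<comment> \<open>Because \<open>i\<close> is not in \<open>I\<close>, updating coordinate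
          \<open>i\<close> and taking the convex combination can be interchanged.\<close>
        by (rule back_subst[of "wgm_le s _ _"])
          (use insert.hyps(2) in \<open>auto intro!: arg_cong[of _ _ h] simp: fun_eq_iff restrict_def\<close>)
    qed (use s xy in \<open>auto intro!: sec\<close>)
  qed (intro meas insert.prems)+
  then show ?case
    by (simp add: product_nn_integral_insert[OF insert.hyps])
qed

text \<open>Lebesgue measure is the image of the product measure under the coordinate map
  \<open>E\<close>, and \<open>E\<close> is linear, so convex combinations carry over.\<close>

theorem prekopa_leindler:
  fixes u v h :: "'a :: euclidean_space \<Rightarrow> ennreal"
  assumes [measurable]: "u \<in> borel_measurable borel" "v \<in> borel_measurable borel" "h \<in> borel_measurable borel"
    and s: "0 < s" "s < 1"
    and le: "\<And>x y. wgm_le s (u x) (v y) (h (s *\<^sub>R x + (1 - s) *\<^sub>R y))"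
  shows "wgm_le s (\<integral>\<^sup>+x. u x \<partial>lborel) (\<integral>\<^sup>+x. v x \<partial>lborel) (\<integral>\<^sup>+x. h x \<partial>lborel)"
proof -
  define E where "E f = (\<Sum>b\<in>Basis. f b *\<^sub>R b)" for f :: "'a \<Rightarrow> real"
  have [measurable]: "E \<in> Pi\<^sub>M Basis (\<lambda>_. lborel) \<rightarrow>\<^sub>M borel"
    unfolding E_def by measurable
  have int: "(\<integral>\<^sup>+x. f x \<partial>lborel) = (\<integral>\<^sup>+x. f (E x) \<partial>Pi\<^sub>M Basis (\<lambda>_. lborel))"
    if [measurable]: "f \<in> borel_measurable borel" for f :: "'a \<Rightarrow> ennreal"
    unfolding lborel_eq[where 'a='a] E_def[symmetric] by (rule nn_integral_distr) auto
  have "wgm_le s (\<integral>\<^sup>+x. u (E x) \<partial>Pi\<^sub>M Basis (\<lambda>_. lborel)) (\<integral>\<^sup>+x. v (E x) \<partial>Pi\<^sub>M Basis (\<lambda>_. lborel))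
    (\<integral>\<^sup>+x. h (E x) \<partial>Pi\<^sub>M Basis (\<lambda>_. lborel))"
  proof (rule prekopa_leindler_PiM)
    fix x y :: "'a \<Rightarrow> real"
    have "E (\<lambda>i\<in>Basis. s * x i + (1 - s) * y i) = s *\<^sub>R E x + (1 - s) *\<^sub>R E y"
      by (simp add: E_def scaleR_left_distrib sum.distrib scaleR_sum_right)
    then show "wgm_le s (u (E x)) (v (E y)) (h (E (\<lambda>i\<in>Basis. s * x i + (1 - s) * y i)))"
      using le by simp
  qed (use s in measurable)
  then show ?thesis by (simp add: int)
qed

lemma wgm_leI_ennreal:
  assumes "0 < s" "s < 1" "ennreal (p powr s * q powr (1 - s)) \<le> w"
  shows "wgm_le s (ennreal p) (ennreal q) w"
  unfolding wgm_le_def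
proof safe
  fix a b assume "0 < a" "0 < b" "ennreal a < ennreal p" "ennreal b < ennreal q"
  then have "a \<le> p" "b \<le> q" by (auto simp: ennreal_less_iff)
  then have "a powr s * b powr (1 - s) \<le> p powr s * q powr (1 - s)"
    using assms(1,2) \<open>0 < a\<close> \<open>0 < b\<close> by (intro mult_mono powr_mono2) auto
  then show "ennreal (a powr s * b powr (1 - s)) \<le> w"
    using assms(3) by (meson ennreal_leI order_trans)
qed

text \<open>Approximate \<open>p\<close> and \<open>q\<close> strictly from below by
  \<open>z * p\<close> and \<open>z * q\<close>. The geometric mean is homogeneous of degree one, so
  a factor \<open>z\<close> comes out, and \<open>z\<close> is arbitrarily close to
  \<open>1\<close>.\<close>

lemma wgm_le_ennrealD:
  assumes "wgm_le s (ennreal p) (ennreal q) (ennreal w)" "0 < p" "0 < q" "0 \<le> w"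
  shows "p powr s * q powr (1 - s) \<le> w"
proof (rule field_le_mult_one_interval)
  fix z :: real assume z: "0 < z" "z < 1"
  have "ennreal ((z * p) powr s * (z * q) powr (1 - s)) \<le> ennreal w"
    using z assms(2,3) by (intro wgm_leD[OF assms(1)]) (auto simp: ennreal_less_iff)
  then have "(z * p) powr s * (z * q) powr (1 - s) \<le> w" using assms(4) by simp
  also have "(z * p) powr s * (z * q) powr (1 - s) = (z powr s * z powr (1 - s)) * (p powr s * q powr (1 - s))"
    using z assms(2,3) by (simp add: powr_mult)
  also have "z powr s * z powr (1 - s) = z" using z by (simp add: powr_add[symmetric])
  finally show "z * (p powr s * q powr (1 - s)) \<le> w" .
qed

section \<open>The standard normal distribution on Euclidean space\<close>

lemma nn_integral_lborel_scaleR: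
  fixes f :: "'a :: euclidean_space \<Rightarrow> ennreal"
  assumes [measurable]: "f \<in> borel_measurable borel" and c: "c \<noteq> 0"
  shows "(\<integral>\<^sup>+x. f x \<partial>lborel) = ennreal (\<bar>c\<bar> ^ DIM('a)) * (\<integral>\<^sup>+x. f (c *\<^sub>R x) \<partial>lborel)"
  by (subst lborel_affine[OF c, of 0]) (simp add: nn_integral_density nn_integral_distr nn_integral_cmult)

text \<open>This radial form makes evenness, behaviour under scaling and strong log-concavity of the
  density visible.\<close>

lemma std_normal_vector_density_eq:
  fixes x :: "real ^ 'n"
  shows "std_normal_vector_density x = (1 / sqrt (2 * pi)) ^ CARD('n) * exp (- (norm x)\<^sup>2 / 2)"
proof -
  have "std_normal_vector_density x = (\<Prod>i\<in>UNIV. (1 / sqrt (2 * pi)) * exp (- (x $ i)\<^sup>2 / 2))"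
    by (simp add: std_normal_vector_density_def std_normal_density_def)
  also have "\<dots> = (1 / sqrt (2 * pi)) ^ CARD('n) * exp (\<Sum>i\<in>UNIV. - (x $ i)\<^sup>2 / 2)"
    by (simp add: prod_dividef exp_sum power_divide)
  also have "(\<Sum>i\<in>UNIV. - (x $ i)\<^sup>2 / 2) = - (norm x)\<^sup>2 / 2"
    by (simp add: norm_vec_def L2_set_def sum_nonneg sum_divide_distrib[symmetric] sum_negf)
  finally show ?thesis .
qed

lemma std_normal_vector_density_pos [simp]: "0 < std_normal_vector_density x"
  by (simp add: std_normal_vector_density_eq)

lemma std_normal_vector_density_nonneg [simp]: "0 \<le> std_normal_vector_density x"
  by (simp add: less_imp_le)

lemma measurable_std_normal_vector_density [measurable]: "std_normal_vector_density \<in> borel_measurable borel"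
  unfolding std_normal_vector_density_eq[abs_def] by measurable

lemma sets_std_normal_vector_measure [simp, measurable_cong]: "sets std_normal_vector_measure = sets borel"
  by (simp add: std_normal_vector_measure_def)

lemma space_std_normal_vector_measure [simp]: "space std_normal_vector_measure = UNIV"
  by (simp add: std_normal_vector_measure_def)

lemma nn_integral_std_normal_vector_measure:
  fixes f :: "real ^ 'n \<Rightarrow> ennreal"
  assumes [measurable]: "f \<in> borel_measurable borel"
  shows "(\<integral>\<^sup>+x. f x \<partial>std_normal_vector_measure) = (\<integral>\<^sup>+x. ennreal (std_normal_vector_density x) * f x \<partial>lborel)"
  by (simp add: std_normal_vector_measure_def nn_integral_density)

text \<open>Rewritten as a product over \<open>Basis\<close>, the density integrates to a product of
  one-dimensional Gaussian integrals.\<close>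

lemma nn_integral_std_normal_vector_density:
  "(\<integral>\<^sup>+x. ennreal (std_normal_vector_density (x :: real ^ 'n)) \<partial>lborel) = 1"
proof -
  have B: "(Basis :: (real ^ 'n) set) = range (\<lambda>i. axis i 1)" by (auto simp: Basis_vec_def)
  have "(\<integral>\<^sup>+x. ennreal (std_normal_vector_density (x :: real ^ 'n)) \<partial>lborel)
    = (\<integral>\<^sup>+x. ennreal (\<Prod>b\<in>Basis. std_normal_density ((x :: real ^ 'n) \<bullet> b)) \<partial>lborel)"
    unfolding B by (subst prod.reindex) (auto simp: std_normal_vector_density_def inj_on_def axis_eq_axis inner_axis)
  also have "\<dots> = (\<integral>\<^sup>+x. (\<Prod>b\<in>Basis. ennreal (std_normal_density ((x :: real ^ 'n) \<bullet> b))) \<partial>lborel)"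
    by (simp add: prod_ennreal normal_density_nonneg)
  also have "\<dots> = (\<Prod>b\<in>(Basis :: (real ^ 'n) set). \<integral>\<^sup>+x. ennreal (std_normal_density x) \<partial>lborel)"
    by (rule nn_integral_lborel_prod) auto
  also have "\<dots> = 1"
    by (simp add: nn_integral_eq_integral normal_density_nonneg)
  finally show ?thesis .
qed

lemma prob_space_std_normal_vector_measure: "prob_space (std_normal_vector_measure :: (real ^ 'n) measure)"
proof
  show "emeasure (std_normal_vector_measure :: (real ^ 'n) measure) (space std_normal_vector_measure) = 1"
    using nn_integral_std_normal_vector_density
    by (simp add: std_normal_vector_measure_def emeasure_density)
qed

lemma emeasure_std_normal_vector_measure_uminus:
  fixes S :: "(real ^ 'n) set"
  assumes [measurable]: "S \<in> sets borel"
  shows "emeasure std_normal_vector_measure {x. - x \<in> S} = emeasure std_normal_vector_measure S"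
proof -
  have "emeasure std_normal_vector_measure S = (\<integral>\<^sup>+x. ennreal (std_normal_vector_density x) * indicator S x \<partial>lborel)"
    by (simp add: std_normal_vector_measure_def emeasure_density)
  also have "\<dots> = (\<integral>\<^sup>+x. ennreal (std_normal_vector_density (- x)) * indicator S (- x) \<partial>lborel)"
    by (subst nn_integral_lborel_scaleR[where c="-1"]) auto
  also have "\<dots> = (\<integral>\<^sup>+x. ennreal (std_normal_vector_density x) * indicator {x. - x \<in> S} x \<partial>lborel)"
    by (simp add: std_normal_vector_density_eq indicator_def)
  also have "\<dots> = emeasure std_normal_vector_measure {x. - x \<in> S}"
    by (subst std_normal_vector_measure_def, subst emeasure_density) auto
  finally show ?thesis by simp
qed

text \<open>Half of the Gaussian exponent is spent on dominating the norm; what remains is a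
  Gaussian dilated by \<open>sqrt 2\<close>, whose integral is finite.\<close>

lemma integrable_norm_std_normal_vector_measure:
  "integrable (std_normal_vector_measure :: (real ^ 'n) measure) norm"
proof (rule integrableI_bounded)
  have *: "std_normal_vector_density x * norm x \<le> 2 * std_normal_vector_density ((1 / sqrt 2) *\<^sub>R x)" for x :: "real ^ 'n"
  proof -
    let ?t = "norm x"
    have "0 \<le> (?t / 2 - 1)\<^sup>2" by simp
    also have "\<dots> = 1 + ?t\<^sup>2 / 4 - ?t" by (simp add: power2_diff power_divide)
    finally have "?t \<le> 1 + ?t\<^sup>2 / 4" by simp
    also have "\<dots> \<le> 2 * (1 + ?t\<^sup>2 / 4)" by simp
    also have "\<dots> \<le> 2 * exp (?t\<^sup>2 / 4)" by (rule mult_left_mono[OF exp_ge_add_one_self]) simp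
    finally have "exp (- ?t\<^sup>2 / 2) * ?t \<le> exp (- ?t\<^sup>2 / 2) * (2 * exp (?t\<^sup>2 / 4))"
      by (intro mult_left_mono) auto
    also have "\<dots> = 2 * exp (- ?t\<^sup>2 / 4)" by (simp add: mult_exp_exp)
    finally have "exp (- ?t\<^sup>2 / 2) * ?t \<le> 2 * exp (- ?t\<^sup>2 / 4)" .
    from mult_left_mono[OF this, of "(1 / sqrt (2 * pi)) ^ CARD('n)"]
    show ?thesis by (simp add: std_normal_vector_density_eq power_divide power_mult_distrib mult_ac)
  qed
  have "(\<integral>\<^sup>+x. ennreal (norm (norm x)) \<partial>(std_normal_vector_measure :: (real ^ 'n) measure))
     = (\<integral>\<^sup>+x. ennreal (std_normal_vector_density (x :: real ^ 'n) * norm x) \<partial>lborel)"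
    by (simp add: nn_integral_std_normal_vector_measure ennreal_mult)
  also have "\<dots> \<le> (\<integral>\<^sup>+x. ennreal (2 * std_normal_vector_density ((1 / sqrt 2) *\<^sub>R x :: real ^ 'n)) \<partial>lborel)"
    using * by (intro nn_integral_mono ennreal_leI)
  also have "\<dots> = 2 * (\<integral>\<^sup>+x. ennreal (std_normal_vector_density ((1 / sqrt 2) *\<^sub>R x :: real ^ 'n)) \<partial>lborel)"
    by (simp add: ennreal_mult nn_integral_cmult)
  also have "\<dots> = 2 * ennreal (\<bar>sqrt 2\<bar> ^ DIM(real ^ 'n))"
    by (subst nn_integral_lborel_scaleR[where c="sqrt 2"]) (simp_all add: nn_integral_std_normal_vector_density)
  also have "\<dots> < \<infinity>" by (simp add: ennreal_mult_less_top)
  finally show "(\<integral>\<^sup>+x. ennreal (norm (norm x)) \<partial>(std_normal_vector_measure :: (real ^ 'n) measure)) < \<infinity>" .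
qed simp

section \<open>Gaussian concentration for Lipschitz functions\<close>

text \<open>The last term is the strong convexity of the squared norm; it supplies the quadratic
  gain that absorbs Lipschitz differences.\<close>

lemma norm_convex_combination_sq:
  fixes x y :: "'a :: real_inner"
  shows "(norm (s *\<^sub>R x + (1 - s) *\<^sub>R y))\<^sup>2 =
    s * (norm x)\<^sup>2 + (1 - s) * (norm y)\<^sup>2 - s * (1 - s) * (norm (x - y))\<^sup>2"
  unfolding power2_norm_eq_inner
  by (simp add: inner_add_left inner_add_right inner_diff_left inner_diff_right inner_commute[of y x] algebra_simps)

text \<open>Prekopa-Leindler is applied to \<open>d * exp (f - K)\<close>, \<open>d * exp (- s / (1 - s) * f)\<close> and \<open>d\<close>, where \<open>d\<close> is
  the Gaussian density; its strong log-concavity absorbs \<open>f x - f y\<close> up to the constant \<open>K\<close>.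
  Jensen's inequality bounds the second integral from below.\<close>

lemma lipschitz_exp_moment_weighted:
  fixes f :: "real ^ 'n \<Rightarrow> real"
  assumes lip: "\<And>x y. f x - f y \<le> L * norm (x - y)" and bdd: "\<And>x. \<bar>f x\<bar> \<le> B"
    and [measurable]: "f \<in> borel_measurable borel"
    and s: "0 < s" "s < 1"
  shows "(LINT x|std_normal_vector_measure. exp (f x))
    \<le> exp ((LINT x|std_normal_vector_measure. f x) + L\<^sup>2 / (2 * (1 - s)))"
proof -
  let ?G = "std_normal_vector_measure :: (real ^ 'n) measure"
  let ?d = "std_normal_vector_density :: real ^ 'n \<Rightarrow> real"
  interpret prob_space ?G by (rule prob_space_std_normal_vector_measure)
  \<comment> \<open>\<open>K\<close> is the maximum over \<open>t\<close> of
    \<open>L * t - (1 - s) * t\<^sup>2 / 2\<close>, found by completing the square.\<close>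
  define K where "K = L\<^sup>2 / (2 * (1 - s))"
  \<comment> \<open>This choice gives \<open>(1 - s) * c = - s\<close>, so that after weighting
    \<open>f y\<close> cancels against \<open>f x\<close> with the same factor
    \<open>s\<close>.\<close>
  define c where "c = - (s / (1 - s))"
  have int[simp]: "integrable ?G f" "integrable ?G (\<lambda>x. exp (f x - K))" "integrable ?G (\<lambda>x. exp (c * f x))"
      "integrable ?G (\<lambda>x. exp (f x))"
  proof -
    show "integrable ?G f"
      by (rule integrable_const_bound[of _ B]) (auto simp: bdd)
    show "integrable ?G (\<lambda>x. exp (f x))"
      using bdd by (intro integrable_const_bound[of _ "exp B"]) (auto simp: abs_le_iff)
    then show "integrable ?G (\<lambda>x. exp (f x - K))" by (simp add: exp_diff)
    have "c * f x \<le> \<bar>c\<bar> * B" for x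
    proof -
      have "c * f x \<le> \<bar>c\<bar> * \<bar>f x\<bar>" by (simp add: abs_mult[symmetric])
      also have "\<dots> \<le> \<bar>c\<bar> * B" using bdd by (intro mult_left_mono) auto
      finally show ?thesis .
    qed
    then show "integrable ?G (\<lambda>x. exp (c * f x))"
      by (intro integrable_const_bound[of _ "exp (\<bar>c\<bar> * B)"]) auto
  qed
  define P where "P = (LINT x|?G. exp (f x - K))"
  define Q where "Q = (LINT x|?G. exp (c * f x))"
  define m where "m = (LINT x|?G. f x)"
  have QJ: "exp (c * m) \<le> Q"
  proof -
    have "exp (LINT x|?G. c * f x) \<le> (LINT x|?G. exp (c * f x))"
      by (rule jensens_inequality[where I=UNIV]) (auto simp: exp_convex)
    then show ?thesis by (simp add: Q_def m_def)
  qed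
  have lb: "- B \<le> f x" for x using bdd[of x] by linarith
  from QJ have Q0: "Q > 0" using exp_gt_zero less_le_trans by blast
  have PE: "P = (LINT x|?G. exp (f x)) / exp K"
    by (simp add: P_def exp_diff)
  have "exp (- B - K) \<le> P"
  proof -
    have "(LINT x|?G. exp (- B - K)) \<le> P"
      unfolding P_def using lb by (intro integral_mono) auto
    then show ?thesis using prob_space by simp
  qed
  then have P0: "P > 0" using exp_gt_zero less_le_trans by blast
  have "wgm_le s (\<integral>\<^sup>+x. ennreal (?d x * exp (f x - K)) \<partial>lborel) (\<integral>\<^sup>+x. ennreal (?d x * exp (c * f x)) \<partial>lborel)
    (\<integral>\<^sup>+x. ennreal (?d x) \<partial>lborel)"
  proof (rule prekopa_leindler)
    fix x y :: "real ^ 'n"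
    define C where "C = (1 / sqrt (2 * pi)) ^ CARD('n)"
    have C0: "C > 0" by (simp add: C_def)
    let ?t = "norm (x - y)"
    have "L * ?t \<le> (1 - s) * ?t\<^sup>2 / 2 + K"
    proof -
      have "0 \<le> ((1 - s) * ?t - L)\<^sup>2 / (2 * (1 - s))" using s by simp
      also have "\<dots> = (1 - s) * ?t\<^sup>2 / 2 + K - L * ?t"
        using s by (simp add: K_def power2_eq_square field_simps)
      finally show ?thesis by simp
    qed
    then have "f x - f y - K \<le> (1 - s) * ?t\<^sup>2 / 2" using lip[of x y] by linarith
    then have key: "s * (f x - f y - K) \<le> s * ((1 - s) * ?t\<^sup>2 / 2)" using s by simp
    have sc: "(1 - s) * c = - s" using s by (simp add: c_def)
    have "(?d x * exp (f x - K)) powr s * (?d y * exp (c * f y)) powr (1 - s)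
      = (C powr s * C powr (1 - s)) * (exp (s * (- (norm x)\<^sup>2 / 2 + (f x - K)))
         * exp ((1 - s) * (- (norm y)\<^sup>2 / 2 + c * f y)))"
      using C0 by (simp add: std_normal_vector_density_eq C_def[symmetric] powr_mult exp_powr_real mult.assoc mult_exp_exp)
    also have "C powr s * C powr (1 - s) = C" using C0 by (simp add: powr_add[symmetric])
    also have "exp (s * (- (norm x)\<^sup>2 / 2 + (f x - K))) * exp ((1 - s) * (- (norm y)\<^sup>2 / 2 + c * f y))
       \<le> exp (- (norm (s *\<^sub>R x + (1 - s) *\<^sub>R y))\<^sup>2 / 2)"
    proof -
      have "s * (- (norm x)\<^sup>2 / 2 + (f x - K)) + (1 - s) * (- (norm y)\<^sup>2 / 2 + c * f y)
        = - (s * (norm x)\<^sup>2 + (1 - s) * (norm y)\<^sup>2) / 2 + s * (f x - K) + ((1 - s) * c) * f y"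
        by (simp add: right_diff_distrib left_diff_distrib distrib_left distrib_right add_divide_distrib diff_divide_distrib)
      also have "\<dots> = - (s * (norm x)\<^sup>2 + (1 - s) * (norm y)\<^sup>2) / 2 + s * (f x - f y - K)"
        unfolding sc by (simp add: algebra_simps)
      also have "\<dots> \<le> - (s * (norm x)\<^sup>2 + (1 - s) * (norm y)\<^sup>2) / 2 + s * ((1 - s) * ?t\<^sup>2 / 2)"
        using key by simp
      also have "\<dots> = - (norm (s *\<^sub>R x + (1 - s) *\<^sub>R y))\<^sup>2 / 2"
        unfolding norm_convex_combination_sq
        by (simp add: right_diff_distrib left_diff_distrib distrib_left distrib_right add_divide_distrib diff_divide_distrib mult.assoc)
      finally show ?thesis by (simp add: mult_exp_exp)
    qed
    finally have "(?d x * exp (f x - K)) powr s * (?d y * exp (c * f y)) powr (1 - s)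
      \<le> ?d (s *\<^sub>R x + (1 - s) *\<^sub>R y)"
      using C0 by (simp add: std_normal_vector_density_eq C_def[symmetric])
    then show "wgm_le s (ennreal (?d x * exp (f x - K))) (ennreal (?d y * exp (c * f y)))
        (ennreal (?d (s *\<^sub>R x + (1 - s) *\<^sub>R y)))"
      using s by (intro wgm_leI_ennreal ennreal_leI)
  qed (use s in auto)
  moreover have "(\<integral>\<^sup>+x. ennreal (?d x * exp (g x)) \<partial>lborel) = ennreal (LINT x|?G. exp (g x))"
    if [measurable]: "g \<in> borel_measurable borel" and "integrable ?G (\<lambda>x. exp (g x))" for g :: "real ^ 'n \<Rightarrow> real"
    using nn_integral_std_normal_vector_measure[of "\<lambda>x. ennreal (exp (g x))"] nn_integral_eq_integral[OF that(2)]
    by (simp add: ennreal_mult)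
  ultimately have "wgm_le s (ennreal P) (ennreal Q) (ennreal 1)"
    by (simp add: P_def Q_def nn_integral_std_normal_vector_density)
  from wgm_le_ennrealD[OF this P0 Q0]
  have PQ: "P powr s * Q powr (1 - s) \<le> 1" by simp
  \<comment> \<open>Jensen's bound on \<open>Q\<close> turns the product inequality into one between
    \<open>s\<close>-th powers, whose roots give \<open>P \<le> exp m\<close>.\<close>
  have "P powr s * exp (- s * m) = P powr s * exp (c * m) powr (1 - s)"
    using s by (simp add: exp_powr_real c_def)
  also have "\<dots> \<le> P powr s * Q powr (1 - s)"
    using QJ s by (intro mult_left_mono powr_mono2) auto
  finally have "P powr s * exp (- s * m) \<le> 1" using PQ by simp
  then have "P powr s \<le> exp (s * m)" by (simp add: exp_minus field_simps)
  then have "P powr s \<le> exp m powr s" by (simp add: exp_powr_real mult.commute)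
  then have "P \<le> exp m" using s P0 by (smt (verit) powr_less_mono2 exp_gt_zero)
  then show ?thesis by (simp add: PE m_def K_def exp_add field_simps)
qed

text \<open>Let the weight \<open>s\<close> tend to \<open>0\<close> from above: the exponent then
  decreases to the sharp one.\<close>

lemma lipschitz_exp_moment_bounded:
  fixes f :: "real ^ 'n \<Rightarrow> real"
  assumes lip: "\<And>x y. f x - f y \<le> L * norm (x - y)" and bdd: "\<And>x. \<bar>f x\<bar> \<le> B"
    and meas: "f \<in> borel_measurable borel"
  shows "(LINT x|std_normal_vector_measure. exp (f x))
    \<le> exp ((LINT x|std_normal_vector_measure. f x) + L\<^sup>2 / 2)"
proof -
  let ?m = "(LINT x|std_normal_vector_measure. f x)"
  let ?E = "(LINT x|std_normal_vector_measure. exp (f x))"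
  have "((\<lambda>s. exp (?m + L\<^sup>2 / (2 * (1 - s)))) \<longlongrightarrow> exp (?m + L\<^sup>2 / (2 * (1 - 0)))) (at_right 0)"
    by (intro tendsto_intros) auto
  moreover have "eventually (\<lambda>s. ?E \<le> exp (?m + L\<^sup>2 / (2 * (1 - s)))) (at_right 0)"
    unfolding eventually_at_right_field
    using lipschitz_exp_moment_weighted[OF lip bdd meas] by (intro exI[of _ 1]) auto
  ultimately have "?E \<le> exp (?m + L\<^sup>2 / (2 * (1 - 0)))"
    by (rule tendsto_lowerbound) simp
  then show ?thesis by simp
qed

text \<open>A Lipschitz function grows at most linearly, and the norm is integrable.\<close>

lemma lipschitz_integrable:
  fixes f :: "real ^ 'n \<Rightarrow> real"
  assumes lip: "\<And>x y. f x - f y \<le> L * norm (x - y)"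
    and [measurable]: "f \<in> borel_measurable borel"
  shows "integrable std_normal_vector_measure f"
proof -
  interpret prob_space "std_normal_vector_measure :: (real ^ 'n) measure"
    by (rule prob_space_std_normal_vector_measure)
  have "\<bar>f x\<bar> \<le> \<bar>f 0\<bar> + L * norm x" for x
    using lip[of x 0] lip[of 0 x] by simp
  then show ?thesis
    by (intro Bochner_Integration.integrable_bound[of _ "\<lambda>x. \<bar>f 0\<bar> + L * norm x" f])
       (auto intro!: Bochner_Integration.integrable_add integrable_mult_right
          integrable_norm_std_normal_vector_measure intro: order_trans[OF _ abs_ge_self])
qed

text \<open>Clipping \<open>f\<close> to \<open>[-n, n]\<close> keeps the Lipschitz bound. Fatou's
  lemma handles the exponentials, and dominated convergence with bound
  \<open>\<bar>f x\<bar>\<close> handles the means.\<close>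

lemma lipschitz_exp_moment:
  fixes f :: "real ^ 'n \<Rightarrow> real"
  assumes lip: "\<And>x y. f x - f y \<le> L * norm (x - y)"
    and [measurable]: "f \<in> borel_measurable borel"
  shows "(\<integral>\<^sup>+x. ennreal (exp (f x)) \<partial>std_normal_vector_measure)
    \<le> ennreal (exp ((LINT x|std_normal_vector_measure. f x) + L\<^sup>2 / 2))"
proof -
  let ?G = "std_normal_vector_measure :: (real ^ 'n) measure"
  interpret prob_space ?G by (rule prob_space_std_normal_vector_measure)
  define g where "g n x = max (- real n) (min (f x) (real n))" for n x
  have [measurable]: "g n \<in> borel_measurable borel" for n unfolding g_def by measurable
  have gb: "\<bar>g n x\<bar> \<le> real n" for n x by (auto simp: g_def)
  have gf: "\<bar>g n x\<bar> \<le> \<bar>f x\<bar>" for n x by (auto simp: g_def)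
  \<comment> \<open>Adding the Lipschitz bounds for both orders of \<open>x\<close> and
    \<open>y\<close> yields this sign, which covers the cases where clipping makes the difference
    zero or negative.\<close>
  have L0: "0 \<le> L * norm (x - y)" for x y :: "real ^ 'n"
    using lip[of x y] lip[of y x] by (simp add: norm_minus_commute)
  have glip: "g n x - g n y \<le> L * norm (x - y)" for n x y
    using lip[of x y] L0[of x y] by (auto simp: g_def max_def min_def)
  have glim: "(\<lambda>n. g n x) \<longlonglongrightarrow> f x" for x
  proof (rule tendsto_eventually)
    obtain N where "\<bar>f x\<bar> \<le> real N" using real_arch_simple by blast
    then show "\<forall>\<^sub>F n in sequentially. g n x = f x"
      by (intro eventually_sequentiallyI[of N]) (auto simp: g_def)
  qed
  have "(\<lambda>n. LINT x|?G. g n x) \<longlonglongrightarrow> (LINT x|?G. f x)"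
    by (rule integral_dominated_convergence[where w="\<lambda>x. \<bar>f x\<bar>"])
       (use lipschitz_integrable[OF lip] glim gf in auto)
  then have lim: "(\<lambda>n. ennreal (exp ((LINT x|?G. g n x) + L\<^sup>2 / 2))) \<longlonglongrightarrow> ennreal (exp ((LINT x|?G. f x) + L\<^sup>2 / 2))"
    by (intro tendsto_intros)
  have "(\<integral>\<^sup>+x. ennreal (exp (f x)) \<partial>?G) = (\<integral>\<^sup>+x. liminf (\<lambda>n. ennreal (exp (g n x))) \<partial>?G)"
  proof (rule nn_integral_cong)
    fix x :: "real ^ 'n"
    have "(\<lambda>n. ennreal (exp (g n x))) \<longlonglongrightarrow> ennreal (exp (f x))"
      by (intro tendsto_intros glim)
    then show "ennreal (exp (f x)) = liminf (\<lambda>n. ennreal (exp (g n x)))"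
      by (intro lim_imp_Liminf[symmetric]) auto
  qed
  also have "\<dots> \<le> liminf (\<lambda>n. \<integral>\<^sup>+x. ennreal (exp (g n x)) \<partial>?G)"
    by (rule nn_integral_liminf) measurable
  also have "\<dots> \<le> liminf (\<lambda>n. ennreal (exp ((LINT x|?G. g n x) + L\<^sup>2 / 2)))"
  proof (rule Liminf_mono, rule always_eventually, safe)
    fix n
    have "integrable ?G (\<lambda>x. exp (g n x))"
      using gb by (intro integrable_const_bound[of _ "exp (real n)"]) (auto simp: abs_le_iff)
    then have "(\<integral>\<^sup>+x. ennreal (exp (g n x)) \<partial>?G) = ennreal (LINT x|?G. exp (g n x))"
      by (intro nn_integral_eq_integral) auto
    then show "(\<integral>\<^sup>+x. ennreal (exp (g n x)) \<partial>?G) \<le> ennreal (exp ((LINT x|?G. g n x) + L\<^sup>2 / 2))"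
      using lipschitz_exp_moment_bounded[OF glip gb, of n] by (simp add: ennreal_leI)
  qed
  also have "\<dots> = ennreal (exp ((LINT x|?G. f x) + L\<^sup>2 / 2))"
    using lim by (intro lim_imp_Liminf) auto
  finally show ?thesis .
qed

text \<open>The inequality is strict because equality in Markov's inequality would force \<open>f\<close> to be almost
  everywhere equal to a constant above its mean.\<close>

lemma lipschitz_tail_less:
  fixes f :: "real ^ 'n \<Rightarrow> real"
  assumes lip: "\<And>x y. f x - f y \<le> L * norm (x - y)"
    and [measurable]: "f \<in> borel_measurable borel"
    and L: "0 < L" and s: "0 < s"
  shows "measure std_normal_vector_measure {x. (LINT x|std_normal_vector_measure. f x) + s \<le> f x}
    < exp (- (s\<^sup>2 / (2 * L\<^sup>2)))"
proof -
  let ?G = "std_normal_vector_measure :: (real ^ 'n) measure"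
  interpret prob_space ?G by (rule prob_space_std_normal_vector_measure)
  define m where "m = (LINT x|?G. f x)"
  \<comment> \<open>The minimizer of \<open>l\<^sup>2 * L\<^sup>2 / 2 - l * s\<close>, the exponent
    in the Chernoff bound.\<close>
  define l where "l = s / L\<^sup>2"
  define c where "c = exp (l * (m + s))"
  define S where "S = {x. m + s \<le> f x}"
  have [measurable]: "S \<in> sets borel" unfolding S_def by measurable
  have l0: "l > 0" using L s by (simp add: l_def)
  have "l * f x - l * f y \<le> (l * L) * norm (x - y)" for x y
    using mult_left_mono[OF lip[of x y], of l] l0 by (simp add: algebra_simps)
  from lipschitz_exp_moment[OF this]
  have le: "(\<integral>\<^sup>+x. ennreal (exp (l * f x)) \<partial>?G) \<le> ennreal (exp (l * m + (l * L)\<^sup>2 / 2))"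
    by (simp add: m_def)
  have int: "integrable ?G (\<lambda>x. exp (l * f x))"
    by (rule integrableI_bounded) (use le in \<open>auto intro: le_less_trans\<close>)
  have E: "(LINT x|?G. exp (l * f x)) \<le> exp (l * m + (l * L)\<^sup>2 / 2)"
    using le nn_integral_eq_integral[OF int] by simp
  \<comment> \<open>\<open>D\<close> is the pointwise gap in Markov's inequality; a positive
    integral of \<open>D\<close> makes that inequality strict.\<close>
  define D where "D x = exp (l * f x) - c * indicator S x" for x
  have D_nn: "0 \<le> D x" for x
    using l0 by (auto simp: D_def c_def S_def indicator_def)
  have D_int: "integrable ?G D"
    unfolding D_def by (intro Bochner_Integration.integrable_diff int integrable_mult_right) (auto simp: integrable_indicator_iff less_top[symmetric])
  have D_eq: "(LINT x|?G. D x) = (LINT x|?G. exp (l * f x)) - c * measure ?G S"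
    unfolding D_def by (subst Bochner_Integration.integral_diff) (auto simp: int integrable_indicator_iff less_top[symmetric])
  have "(LINT x|?G. D x) \<noteq> 0"
  proof
    assume "(LINT x|?G. D x) = 0"
    then have "AE x in ?G. D x = 0"
      using integral_nonneg_eq_0_iff_AE[OF D_int] D_nn by simp
    then have "AE x in ?G. f x = m + s"
    proof eventually_elim
      case (elim x)
      \<comment> \<open>Off \<open>S\<close>, \<open>D x = 0\<close> would make an exponential
        vanish; on \<open>S\<close> it forces \<open>l * f x = l * (m + s)\<close>.\<close>
      then show ?case using l0 by (cases "x \<in> S") (auto simp: D_def c_def)
    qed
    then have "(LINT x|?G. f x) = (LINT x|?G. m + s)"
      by (intro integral_cong_AE) auto
    then show False using s prob_space by (simp add: m_def)
  qed
  moreover have "0 \<le> (LINT x|?G. D x)" using D_nn by (intro integral_nonneg_AE) simp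
  ultimately have "c * measure ?G S < (LINT x|?G. exp (l * f x))" using D_eq by simp
  also note E
  also have "l * m + (l * L)\<^sup>2 / 2 = l * (m + s) + (- (s\<^sup>2 / (2 * L\<^sup>2)))"
    using L by (simp add: l_def field_simps power2_eq_square)
  also have "exp \<dots> = c * exp (- (s\<^sup>2 / (2 * L\<^sup>2)))" by (simp only: exp_add c_def)
  finally show ?thesis by (simp add: c_def S_def m_def)
qed

section \<open>Choice of the Borel set and the two probability bounds\<close>

theorem theorem2p1:
  fixes M :: "'a measure"
    and X :: "'a \<Rightarrow> real ^ 'n"
    and T :: "(real ^ 'n) set"
    and u r :: real
  assumes "standard_normal_vector M X"
    and "T \<noteq> {}"
    and "inradius T > 0"
    and "u > 0"
    and "r \<ge> 2 * scaled_gaussian_width T + u / inradius T"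
  shows "\<exists>A \<in> sets borel.
           \<P>(\<omega> in M. X \<omega> \<in> A) > 1 - exp (- (u\<^sup>2 / 8)) \<and>
           outer_prob_in M X (minus_scaled A r T) < ennreal (exp (- (u\<^sup>2 / 8)))"
proof -
  let ?G = "std_normal_vector_measure :: (real ^ 'n) measure"
  interpret G: prob_space ?G by (rule prob_space_std_normal_vector_measure)
  define \<rho> where "\<rho> = inradius T"
  define w where "w = scaled_gaussian_width T"
  define f where "f x = (SUP t\<in>T. x \<bullet> (t /\<^sub>R (norm t)\<^sup>2))" for x :: "real ^ 'n"
  have \<rho>: "\<rho> > 0" using assms(3) by (simp add: \<rho>_def)
  have nt: "\<rho> \<le> norm t" if "t \<in> T" for t
    unfolding \<rho>_def inradius_def using that by (intro cINF_lower) (auto intro: bdd_belowI[of _ 0])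
  have inner_le: "x \<bullet> (t /\<^sub>R (norm t)\<^sup>2) \<le> 1 / \<rho> * norm x" if "t \<in> T" for t x :: "real ^ 'n"
  proof -
    have "x \<bullet> (t /\<^sub>R (norm t)\<^sup>2) \<le> norm x * norm (t /\<^sub>R (norm t)\<^sup>2)" by (rule norm_cauchy_schwarz)
    also have "norm (t /\<^sub>R (norm t)\<^sup>2) = 1 / norm t" by (simp add: power2_eq_square divide_simps)
    also have "norm x * (1 / norm t) \<le> norm x * (1 / \<rho>)"
      using nt[OF that] \<rho> by (intro mult_left_mono frac_le) auto
    finally show ?thesis by (simp add: mult.commute)
  qed
  have le_f: "x \<bullet> (t /\<^sub>R (norm t)\<^sup>2) \<le> f x" if "t \<in> T" for t x
    unfolding f_def using that inner_le by (intro cSUP_upper bdd_aboveI2)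
  \<comment> \<open>A supremum of linear functionals with norms at most \<open>1 / \<rho>\<close>
    inherits this Lipschitz constant.\<close>
  have lip: "f x - f y \<le> 1 / \<rho> * norm (x - y)" for x y
  proof -
    have "f x \<le> f y + 1 / \<rho> * norm (x - y)"
      unfolding f_def[of x]
    proof (rule cSUP_least[OF assms(2)])
      fix t assume t: "t \<in> T"
      show "x \<bullet> (t /\<^sub>R (norm t)\<^sup>2) \<le> f y + 1 / \<rho> * norm (x - y)"
        using le_f[OF t, of y] inner_le[OF t, of "x - y"] unfolding inner_diff_left by linarith
    qed
    then show ?thesis by simp
  qed
  have "(1 / \<rho>)-lipschitz_on UNIV f"
  proof (rule lipschitz_onI)
    fix x y
    show "dist (f x) (f y) \<le> 1 / \<rho> * dist x y"
      using lip[of x y] lip[of y x] by (simp only: dist_norm norm_minus_commute[of y x] real_norm_def)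
  qed (use \<rho> in simp)
  then have [measurable]: "f \<in> borel_measurable borel"
    by (intro borel_measurable_continuous_onI lipschitz_on_continuous_on)
  have w_eq: "w = (LINT x|?G. f x)"
    by (simp add: w_def scaled_gaussian_width_def f_def)
  \<comment> \<open>Half of the lower bound assumed for \<open>r\<close>. It exceeds the mean
    \<open>w\<close> by \<open>u / (2 * \<rho>)\<close>, and with Lipschitz constant
    \<open>1 / \<rho>\<close> the tail exponent is exactly \<open>u\<^sup>2 / 8\<close>.\<close>
  define k where "k = w + u / (2 * \<rho>)"
  have tail: "measure ?G {x. k \<le> f x} < exp (- (u\<^sup>2 / 8))"
    using lipschitz_tail_less[OF lip, of "u / (2 * \<rho>)"] \<rho> \<open>u > 0\<close>
    by (simp add: k_def w_eq field_simps power2_eq_square)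
  \<comment> \<open>Both probabilities depend only on the law of \<open>X\<close>; as
    \<open>borel\<close> and \<open>lborel\<close> have the same sets, this law is the Gaussian
    measure.\<close>
  have distr: "distr M borel X = ?G" and X[measurable]: "X \<in> M \<rightarrow>\<^sub>M borel"
    using assms(1) unfolding standard_normal_vector_def distributed_def std_normal_vector_measure_def
    by (auto cong: distr_cong)
  define A where "A = {x. f x < k}"
  have [measurable]: "A \<in> sets borel" unfolding A_def by measurable
  show ?thesis
  proof (intro bexI conjI)
    have "\<P>(\<omega> in M. X \<omega> \<in> A) = measure ?G A"
      unfolding distr[symmetric] by (subst measure_distr) (auto intro!: arg_cong[of _ _ "measure M"])
    also have "\<dots> = measure ?G (space ?G - {x. k \<le> f x})"
      by (rule arg_cong[of _ _ "measure ?G"]) (auto simp: A_def)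
    also have "\<dots> = 1 - measure ?G {x. k \<le> f x}"
      by (rule G.prob_compl) simp
    finally show "\<P>(\<omega> in M. X \<omega> \<in> A) > 1 - exp (- (u\<^sup>2 / 8))" using tail by simp
    have sub: "minus_scaled A r T \<subseteq> {x. - x \<in> {x. k \<le> f x}}"
    proof
      fix z assume "z \<in> minus_scaled A r T"
      then obtain a t where z: "z = a - r *\<^sub>R t" "a \<in> A" "t \<in> T" by (auto simp: minus_scaled_def)
      have t0: "norm t > 0" using nt[OF z(3)] \<rho> by linarith
      have "t \<bullet> (t /\<^sub>R (norm t)\<^sup>2) = 1" using t0 by (simp add: power2_norm_eq_inner[symmetric])
      then have "- z \<bullet> (t /\<^sub>R (norm t)\<^sup>2) = r - a \<bullet> (t /\<^sub>R (norm t)\<^sup>2)"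
        by (simp only: z(1) inner_diff_left inner_minus_left inner_scaleR_left)
      moreover have "a \<bullet> (t /\<^sub>R (norm t)\<^sup>2) < k" using le_f[OF z(3), of a] z(2) by (simp add: A_def)
      moreover have "r \<ge> 2 * k" using assms(5) by (simp add: k_def w_def \<rho>_def)
      ultimately show "z \<in> {x. - x \<in> {x. k \<le> f x}}" using le_f[OF z(3), of "- z"] by simp
    qed
    \<comment> \<open>The reflected tail is Borel, so its outer measure is its measure, and Gaussian
      symmetry undoes the reflection.\<close>
    have "outer_prob_in M X (minus_scaled A r T) \<le> outer_measure_of ?G {x. - x \<in> {x. k \<le> f x}}"
      unfolding outer_prob_in_def distr by (rule outer_measure_of_mono[OF sub])
    also have "\<dots> = emeasure ?G {x. - x \<in> {x. k \<le> f x}}"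
      by (rule outer_measure_of_eq) measurable
    also have "\<dots> = emeasure ?G {x. k \<le> f x}"
      by (rule emeasure_std_normal_vector_measure_uminus) measurable
    also have "\<dots> < ennreal (exp (- (u\<^sup>2 / 8)))"
      using tail by (simp add: G.emeasure_eq_measure ennreal_less_iff)
    finally show "outer_prob_in M X (minus_scaled A r T) < ennreal (exp (- (u\<^sup>2 / 8)))" .
  qed measurable
qed

end
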